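(* Let $Q(f)=\sum_{j=1}^{N}w_jf(\mathbf{x}_j)$ be a quadrature formula on $\mathbb{S}^2$, let $n\in\mathbb{N}_0$, and let $L_n:=L_{n,Q}$ denote the associated degree-$n$ hyperinterpolation operator. The optimal constant in the $L^1$--$L^2$ Marcinkiewicz--Zygmund condition of degree $n$ for $Q$ (that is, the infimum of all $C>0$ such that $\sum_{j=1}^N|w_j||p(\mathbf{x}_j)|\leq C\|p\|_{L^2(\mathbb{S}^2)}$ for all $p\in\mathbb{P}_n(\mathbb{S}^2)$) is exactly the operator norm of $L_n$. More precisely, $$\|L_n\|_{C(\mathbb{S}^2)\to L^2(\mathbb{S}^2)}=\sup_{p\in\mathbb{P}_n(\mathbb{S}^2),\, p\neq0}\frac{\sum_{j=1}^{N}|w_j||p(\mathbf{x}_j)|}{\|p\|_{L^2(\mathbb{S}^2)}}.$$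
   Context: $\mathbb{S}^2=\{\mathbf{x}\in\mathbb{R}^3:\|\mathbf{x}\|_2=1\}$ carries the surface measure $\omega$ with $\omega(\mathbb{S}^2)=4\pi$; $C(\mathbb{S}^2)$ is the space of real-valued continuous functions with the uniform norm $\|\cdot\|_\infty$; $L^2(\mathbb{S}^2)$ is taken with respect to $\omega$. $\mathbb{N}_0=\{0,1,2,\ldots\}$. $\mathbb{H}_\ell$ is the space of spherical harmonics of degree $\ell$ (restrictions to $\mathbb{S}^2$ of real harmonic homogeneous polynomials of degree $\ell$ on $\mathbb{R}^3$), $\{Y_{\ell,k}: |k|\le \ell\}$ is an $L^2(\mathbb{S}^2)$-orthonormal basis of $\mathbb{H}_\ell$, and $\mathbb{P}_n(\mathbb{S}^2)=\bigoplus_{\ell=0}^n\mathbb{H}_\ell$. A quadrature formula is a linear functional $Q(f)=\sum_{j=1}^N w_jf(\mathbf{x}_j)$ on $C(\mathbb{S}^2)$ given by $N$ pairwise distinct nodes $\mathbf{x}_1,\ldots,\mathbf{x}_N\in\mathbb{S}^2$ and arbitrary real (possibly signed) weights. The degree-$n$ hyperinterpolation operator associated with $Q$ is $L_{n,Q}:C(\mathbb{S}^2)\to\mathbb{P}_n(\mathbb{S}^2)$, $L_{n,Q}f:=\sum_{\ell=0}^n\sum_{k=-\ell}^{\ell}Q(fY_{\ell,k})\,Y_{\ell,k}$, with operator norm $\|L_{n,Q}\|_{C(\mathbb{S}^2)\to L^2(\mathbb{S}^2)}=\sup_{\|f\|_\infty\le1}\|L_{n,Q}f\|_{L^2(\mathbb{S}^2)}$.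 *)

theory Defs
  imports "HOL-Analysis.Analysis"
begin

abbreviation S2 :: "(real^3) set" where
  "S2 \<equiv> sphere 0 1"

text \<open>
  Real functions on the sphere are functions on the ambient space that are \<open>undefined\<close> off
  \<open>S2\<close> (\<open>extensional S2\<close>), so that equality of such functions is equality on the sphere.
\<close>

text \<open>
  Surface measure as the cone measure: a Borel set \<open>A\<close> of the sphere gets three times the
  Lebesgue measure of \<open>{t x | x \<in> A, 0 < t \<le> 1}\<close>. The factor \<open>3\<close> is the dimension of the ambient
  space and comes from \<open>dx = r\<^sup>2 dr d\<omega>\<close>; here \<open>sgn x\<close> is \<open>x / norm x\<close>.
\<close>

definition surface_measure :: "(real^3) measure" where
  "surface_measure =
     scale_measure 3 (distr (restrict_space lborel (cball 0 1 - {0})) (restrict_space borel S2) sgn)"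

lemma space_surface_measure: "space surface_measure = S2"
  by (simp add: surface_measure_def space_scale_measure space_restrict_space)

lemma sets_surface_measure: "sets surface_measure = sets (restrict_space borel S2)"
  by (simp add: surface_measure_def)

lemma sgn_measurable_surface:
  "sgn \<in> measurable (restrict_space lborel (cball 0 1 - {0})) (restrict_space borel S2)"
proof (rule measurable_restrict_space2)
  show "sgn \<in> space (restrict_space lborel (cball 0 1 - {0::real^3})) \<rightarrow> S2"
    by (auto simp: space_restrict_space norm_sgn)
  have "sgn = (\<lambda>x::real^3. x /\<^sub>R norm x)"
    by (simp add: fun_eq_iff sgn_div_norm)
  then have "(sgn :: real^3 \<Rightarrow> _) \<in> borel_measurable lborel"
    by simp
  then show "sgn \<in> borel_measurable (restrict_space lborel (cball 0 1 - {0::real^3}))"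
    by (rule measurable_restrict_space1)
qed

lemma emeasure_surface_measure:
  assumes "A \<in> sets (restrict_space borel S2)"
  shows "emeasure surface_measure A
    = 3 * emeasure lborel {t *\<^sub>R x | t x. x \<in> A \<and> 0 < t \<and> t \<le> 1}"
proof -
  have A: "A \<subseteq> S2"
    using sets.sets_into_space[OF assms] by (simp add: space_restrict_space)
  have eq: "sgn -` A \<inter> (cball 0 1 - {0}) = {t *\<^sub>R x | t x. x \<in> A \<and> 0 < t \<and> t \<le> 1}"
  proof (intro set_eqI iffI)
    fix y assume "y \<in> sgn -` A \<inter> (cball 0 1 - {0})"
    then show "y \<in> {t *\<^sub>R x | t x. x \<in> A \<and> 0 < t \<and> t \<le> 1}"
      by (intro CollectI exI[of _ "norm y"] exI[of _ "sgn y"]) (auto simp: sgn_div_norm)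
  next
    fix y assume "y \<in> {t *\<^sub>R x | t x. x \<in> A \<and> 0 < t \<and> t \<le> 1}"
    then obtain t x where "y = t *\<^sub>R x" "x \<in> A" "0 < t" "t \<le> 1" by auto
    moreover from this A have "norm x = 1" by auto
    ultimately show "y \<in> sgn -` A \<inter> (cball 0 1 - {0})"
      by (auto simp: sgn_div_norm)
  qed
  have "emeasure surface_measure A
    = 3 * emeasure (restrict_space lborel (cball 0 1 - {0})) (sgn -` A \<inter> (cball 0 1 - {0}))"
    unfolding surface_measure_def
    by (simp add: emeasure_distr[OF sgn_measurable_surface assms] space_restrict_space)
  also have "\<dots> = 3 * emeasure lborel (sgn -` A \<inter> (cball 0 1 - {0}))"
    by (subst emeasure_restrict_space) auto
  finally show ?thesis
    by (simp only: eq)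
qed

lemma emeasure_surface_measure_space: "emeasure surface_measure S2 = ennreal (4 * pi)"
proof -
  have "emeasure surface_measure S2 = 3 * emeasure (restrict_space lborel (cball 0 1 - {0::real^3}))
      (sgn -` S2 \<inter> space (restrict_space lborel (cball 0 1 - {0})))"
    unfolding surface_measure_def
    by (subst emeasure_scale_measure, subst emeasure_distr[OF sgn_measurable_surface])
       (auto simp: sets_restrict_space)
  also have "sgn -` S2 \<inter> space (restrict_space lborel (cball 0 1 - {0::real^3})) = cball 0 1 - {0}"
    by (auto simp: space_restrict_space norm_sgn)
  also have "emeasure (restrict_space lborel (cball 0 1 - {0::real^3})) (cball 0 1 - {0})
      = emeasure lborel (cball 0 1 - {0::real^3})"
    by (subst emeasure_restrict_space) auto
  also have "\<dots> = emeasure lborel (cball 0 1 :: (real^3) set)"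
    by (rule emeasure_Diff_null_set) auto
  also have "\<dots> = ennreal (4 / 3 * pi)"
    by (simp add: emeasure_cball unit_ball_vol_3)
  also have "3 * ennreal (4 / 3 * pi) = ennreal (3 * (4 / 3 * pi))"
    by (subst ennreal_mult) auto
  finally show ?thesis by simp
qed

definition continuous_functions_S2 :: "(real^3 \<Rightarrow> real) set" where
  "continuous_functions_S2 = {f \<in> extensional S2. continuous_on S2 f}"

definition uniform_norm :: "(real^3 \<Rightarrow> real) \<Rightarrow> real" where
  "uniform_norm f = (SUP x\<in>S2. \<bar>f x\<bar>)"

definition L2_inner :: "(real^3 \<Rightarrow> real) \<Rightarrow> (real^3 \<Rightarrow> real) \<Rightarrow> real" where
  "L2_inner f g = (LINT x|surface_measure. f x * g x)"

definition L2_norm :: "(real^3 \<Rightarrow> real) \<Rightarrow> real" where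
  "L2_norm f = sqrt (L2_inner f f)"

definition laplacian :: "('a::euclidean_space \<Rightarrow> real) \<Rightarrow> 'a \<Rightarrow> real" where
  "laplacian f x = (\<Sum>b\<in>Basis. deriv (deriv (\<lambda>t. f (x + t *\<^sub>R b))) 0)"

definition harmonic_homogeneous :: "nat \<Rightarrow> (real^3 \<Rightarrow> real) set" where
  "harmonic_homogeneous l =
     {P. real_polynomial_function P \<and> (\<forall>c x. P (c *\<^sub>R x) = c ^ l * P x) \<and> (\<forall>x. laplacian P x = 0)}"

definition spherical_harmonics :: "nat \<Rightarrow> (real^3 \<Rightarrow> real) set" where
  "spherical_harmonics l = (\<lambda>P. restrict P S2) ` harmonic_homogeneous l"

definition spherical_polynomials :: "nat \<Rightarrow> (real^3 \<Rightarrow> real) set" where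
  "spherical_polynomials n =
     {(\<lambda>x\<in>S2. \<Sum>l\<le>n. h l x) | h. \<forall>l\<le>n. h l \<in> spherical_harmonics l}"

text \<open>The orders \<open>k\<close> of degree \<open>l\<close> run through \<open>-l, \<dots>, l\<close>.\<close>

definition orthonormal_basis_harmonics :: "nat \<Rightarrow> (int \<Rightarrow> real^3 \<Rightarrow> real) \<Rightarrow> bool" where
  "orthonormal_basis_harmonics l Y \<longleftrightarrow>
     (\<forall>k\<in>{-int l..int l}. Y k \<in> spherical_harmonics l) \<and>
     (\<forall>k\<in>{-int l..int l}. \<forall>k'\<in>{-int l..int l}. L2_inner (Y k) (Y k') = (if k = k' then 1 else 0)) \<and>
     (\<forall>f\<in>spherical_harmonics l. \<exists>c. f = (\<lambda>x\<in>S2. \<Sum>k\<in>{-int l..int l}. c k * Y k x))"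

definition quadrature ::
    "nat \<Rightarrow> (nat \<Rightarrow> real^3) \<Rightarrow> (nat \<Rightarrow> real) \<Rightarrow> (real^3 \<Rightarrow> real) \<Rightarrow> real" where
  "quadrature N x w f = (\<Sum>j=1..N. w j * f (x j))"

definition hyperinterpolation ::
    "(nat \<Rightarrow> int \<Rightarrow> real^3 \<Rightarrow> real) \<Rightarrow> nat \<Rightarrow> ((real^3 \<Rightarrow> real) \<Rightarrow> real)
      \<Rightarrow> (real^3 \<Rightarrow> real) \<Rightarrow> (real^3 \<Rightarrow> real)" where
  "hyperinterpolation Y n Q f =
     (\<lambda>x\<in>S2. \<Sum>l\<le>n. \<Sum>k\<in>{-int l..int l}. Q (\<lambda>y\<in>S2. f y * Y l k y) * Y l k x)"

text \<open>
  Suprema and infima are taken in the extended reals, where they exist without any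
  boundedness assumption.
\<close>

definition operator_norm_C_L2 :: "((real^3 \<Rightarrow> real) \<Rightarrow> (real^3 \<Rightarrow> real)) \<Rightarrow> ereal" where
  "operator_norm_C_L2 L =
     (SUP f \<in> {f \<in> continuous_functions_S2. uniform_norm f \<le> 1}. ereal (L2_norm (L f)))"

definition MZ_condition :: "nat \<Rightarrow> (nat \<Rightarrow> real^3) \<Rightarrow> (nat \<Rightarrow> real) \<Rightarrow> nat \<Rightarrow> real \<Rightarrow> bool" where
  "MZ_condition N x w n C \<longleftrightarrow>
     (\<forall>p\<in>spherical_polynomials n. (\<Sum>j=1..N. \<bar>w j\<bar> * \<bar>p (x j)\<bar>) \<le> C * L2_norm p)"

definition MZ_optimal_constant ::
    "nat \<Rightarrow> (nat \<Rightarrow> real^3) \<Rightarrow> (nat \<Rightarrow> real) \<Rightarrow> nat \<Rightarrow> ereal" where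
  "MZ_optimal_constant N x w n = (INF C \<in> {C. C > 0 \<and> MZ_condition N x w n C}. ereal C)"

end

theory Submission
  imports Defs
begin

text \<open>
  Let \<open>c b = Q(f Y\<^sub>b)\<close> be the coefficients of \<open>L f\<close>. For \<open>p = \<Sum> d b Y\<^sub>b\<close> one has
  \<open>Q(f p) = \<Sum> d b c b\<close>, the inner product of \<open>p\<close> and \<open>L f\<close>. Taking \<open>p = L f\<close> bounds the operator
  norm by the Marcinkiewicz--Zygmund constant; taking a continuous \<open>f\<close> bounded by \<open>1\<close> that has the
  sign of \<open>w j p(x j)\<close> at the node \<open>x j\<close> (Tietze) and applying Cauchy--Schwarz gives the converse.

  Parseval's identity needs the orthogonality of harmonics of different degrees. By rotation
  invariance of the measure, the infinitesimal rotations \<open>x\<^sub>i \<partial>\<^sub>j - x\<^sub>j \<partial>\<^sub>i\<close> are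
  skew-symmetric, so the sum of their squares is symmetric, and a harmonic homogeneous polynomial
  of degree \<open>l\<close> is an eigenfunction of that sum with eigenvalue \<open>-l(l + 1)\<close>.
\<close>

section \<open>Rotation invariance of the surface measure\<close>

text \<open>Lebesgue measure is determined by its values on boxes. The preimage of a box under
  \<open>f\<close> is its image under the inverse \<open>g\<close>, which is again orthogonal and
  hence preserves volume.\<close>

lemma lborel_distr_orthogonal:
  fixes f :: "real^'n::{finite,wellorder} \<Rightarrow> real^'n::{finite,wellorder}"
  assumes f: "orthogonal_transformation f"
  shows "distr lborel borel f = lborel"
proof (rule lborel_eqI[symmetric])
  fix l u :: "real^'n::{finite,wellorder}" assume le: "\<And>b. b \<in> Basis \<Longrightarrow> l \<bullet> b \<le> u \<bullet> b"
  obtain g where g: "orthogonal_transformation g" and fg: "\<And>x. f (g x) = x" "\<And>x. g (f x) = x"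
    using orthogonal_transformation_inv[OF f] orthogonal_transformation_bij[OF f]
    by (metis bij_inv_eq_iff)
  have meas: "f \<in> borel_measurable borel"
    using f by (intro borel_measurable_continuous_onI linear_continuous_on)
      (simp add: linear_conv_bounded_linear[symmetric] orthogonal_transformation_linear)
  have eq: "f -` box l u = g ` box l u"
    using fg by (auto simp: image_iff) (metis)
  have "emeasure (distr lborel borel f) (box l u) = emeasure lborel (f -` box l u)"
    using meas by (simp add: emeasure_distr)
  \<comment> \<open>Volume preservation of orthogonal images concerns \<open>lebesgue\<close>; both
    measures agree on this set because, as the preimage of a box, it is Borel.\<close>
  also have "\<dots> = emeasure lebesgue (g ` box l u)"
    using measurable_sets[OF meas, of "box l u"] by (simp add: eq[symmetric])
  also have "\<dots> = ennreal (measure lebesgue (g ` box l u))"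
    using measurable_orthogonal_image[OF g, of "box l u"]
    by (simp add: emeasure_eq_measure2 lmeasurable_box)
  also have "\<dots> = emeasure lebesgue (box l u)"
    using measure_orthogonal_image[OF g, of "box l u"]
    by (simp add: emeasure_eq_measure2 lmeasurable_box)
  finally show "emeasure (distr lborel borel f) (box l u) = (\<Prod>b\<in>Basis. (u - l) \<bullet> b)"
    using le by simp
qed simp

lemma borel_measurable_surface:
  fixes f :: "real^3 \<Rightarrow> real"
  assumes "continuous_on S2 f"
  shows "f \<in> borel_measurable surface_measure"
proof -
  have "f \<in> borel_measurable (restrict_space borel S2)"
    by (rule borel_measurable_continuous_on_restrict) fact
  then show ?thesis
    using measurable_cong_sets[OF sets_surface_measure refl] by blast
qed

lemma finite_measure_surface: "finite_measure surface_measure"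
  by (rule finite_measureI) (simp add: space_surface_measure emeasure_surface_measure_space)

lemma bounded_on_S2:
  fixes f :: "real^3 \<Rightarrow> real"
  assumes f: "continuous_on S2 f"
  obtains B where "\<And>x. x \<in> S2 \<Longrightarrow> \<bar>f x\<bar> \<le> B"
proof -
  have "bounded (f ` S2)"
    by (intro compact_imp_bounded compact_continuous_image f compact_sphere)
  then obtain B where "\<forall>y\<in>f ` S2. norm y \<le> B"
    by (auto simp: bounded_iff)
  then show ?thesis
    by (intro that[of B]) (simp del: mem_sphere_0)
qed

lemma integrable_surface:
  fixes f :: "real^3 \<Rightarrow> real"
  assumes f: "continuous_on S2 f"
  shows "integrable surface_measure f"
proof -
  interpret finite_measure surface_measure by (rule finite_measure_surface)
  obtain B where "\<And>x. x \<in> S2 \<Longrightarrow> \<bar>f x\<bar> \<le> B"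
    using bounded_on_S2[OF f] by blast
  then show ?thesis
    by (intro integrable_const_bound[where B = B])
      (auto simp: space_surface_measure borel_measurable_surface[OF f])
qed

text \<open>A linear isometry commutes with \<open>sgn\<close>, so the cone over the preimage of
  \<open>A\<close> is the preimage of the cone over \<open>A\<close>. The claim thus reduces to the
  invariance of Lebesgue measure.\<close>

lemma surface_measure_distr_orthogonal:
  assumes f: "orthogonal_transformation f"
  shows "distr surface_measure surface_measure f = surface_measure"
proof (rule measure_eqI)
  have lin: "linear f" and nf: "\<And>x. norm (f x) = norm x"
    using f by (auto simp: orthogonal_transformation)
  have cont: "continuous_on A f" for A
    using lin by (simp add: linear_continuous_on linear_conv_bounded_linear)
  have meas: "f \<in> measurable (restrict_space borel S2) (restrict_space borel S2)"
    by (rule measurable_restrict_space3) (auto simp: nf intro: borel_measurable_continuous_onI cont)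
  have meas': "f \<in> measurable surface_measure surface_measure"
    using meas measurable_cong_sets[OF sets_surface_measure sets_surface_measure] by blast
  fix A assume "A \<in> sets (distr surface_measure surface_measure f)"
  then have A: "A \<in> sets (restrict_space borel S2)" and A': "A \<in> sets surface_measure"
    by (simp_all add: sets_surface_measure)
  have AS: "A \<subseteq> S2"
    using sets.sets_into_space[OF A] by (simp add: space_restrict_space)
  define cone where "cone = (\<lambda>A. {t *\<^sub>R x | t x. x \<in> A \<and> 0 < t \<and> t \<le> (1::real)} :: (real^3) set)"
  have cone_eq: "cone B = sgn -` B \<inter> (cball 0 1 - {0})" if "B \<subseteq> S2" for B
  proof (intro set_eqI iffI)
    fix y assume "y \<in> sgn -` B \<inter> (cball 0 1 - {0})"
    then show "y \<in> cone B" unfolding cone_def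
      by (intro CollectI exI[of _ "norm y"] exI[of _ "sgn y"]) (auto simp: sgn_div_norm)
  next
    fix y assume "y \<in> cone B"
    then obtain t x where "y = t *\<^sub>R x" "x \<in> B" "0 < t" "t \<le> 1" by (auto simp: cone_def)
    moreover from this that have "norm x = 1" by auto
    ultimately show "y \<in> sgn -` B \<inter> (cball 0 1 - {0})"
      by (auto simp: sgn_div_norm)
  qed
  have cone_borel: "cone A \<in> sets borel"
  proof -
    have "sgn -` A \<inter> space (restrict_space lborel (cball 0 1 - {0})) \<in>
        sets (restrict_space lborel (cball 0 1 - {0::real^3}))"
      by (rule measurable_sets[OF sgn_measurable_surface A])
    then show ?thesis
      by (simp add: cone_eq[OF AS] space_restrict_space sets_restrict_space_iff)
  qed
  have sgn_f: "sgn (f y) = f (sgn y)" for y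
    by (simp add: sgn_div_norm nf linear_scale[OF lin])
  have f0: "f y = 0 \<longleftrightarrow> y = 0" for y
    using nf[of y] by (metis norm_eq_zero)
  have "emeasure (distr surface_measure surface_measure f) A
      = emeasure surface_measure (f -` A \<inter> S2)"
    using emeasure_distr[OF meas' A'] by (simp add: space_surface_measure)
  also have "\<dots> = 3 * emeasure lborel (cone (f -` A \<inter> S2))"
    unfolding cone_def
    using measurable_sets[OF meas A] by (intro emeasure_surface_measure) (simp add: space_restrict_space)
  also have "cone (f -` A \<inter> S2) = f -` cone A"
    using AS by (auto simp: cone_eq sgn_f nf f0 norm_sgn)
  also have "emeasure lborel (f -` cone A) = emeasure (distr lborel borel f) (cone A)"
    using cone_borel by (subst emeasure_distr) (auto intro: borel_measurable_continuous_onI cont)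
  also have "distr lborel borel f = lborel"
    by (rule lborel_distr_orthogonal[OF f])
  also have "3 * emeasure lborel (cone A) = emeasure surface_measure A"
    unfolding cone_def by (rule emeasure_surface_measure[OF A, symmetric])
  finally show "emeasure (distr surface_measure surface_measure f) A = emeasure surface_measure A" .
qed simp

lemma integral_surface_orthogonal:
  fixes g :: "real^3 \<Rightarrow> real"
  assumes f: "orthogonal_transformation f" and g: "continuous_on S2 g"
  shows "(LINT x|surface_measure. g (f x)) = (LINT x|surface_measure. g x)"
proof -
  have lin: "linear f" and nf: "\<And>x. norm (f x) = norm x"
    using f by (auto simp: orthogonal_transformation)
  have "f \<in> measurable (restrict_space borel S2) (restrict_space borel S2)"
    by (rule measurable_restrict_space3)
      (auto simp: nf intro!: borel_measurable_continuous_onI linear_continuous_on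
        simp: linear_conv_bounded_linear[symmetric] lin)
  then have "f \<in> measurable surface_measure surface_measure"
    using measurable_cong_sets[OF sets_surface_measure sets_surface_measure] by blast
  from integral_distr[OF this borel_measurable_surface[OF g]]
  show ?thesis
    by (simp add: surface_measure_distr_orthogonal[OF f])
qed

section \<open>Partial derivatives of polynomials\<close>

text \<open>A one-variable derivative at \<open>0\<close>, in the same form as in
  \<open>laplacian\<close>; for polynomials it is a component of the total derivative
  (\<open>has_derivative_partial\<close>).\<close>

definition partial :: "'n \<Rightarrow> (real^'n \<Rightarrow> real) \<Rightarrow> real^'n \<Rightarrow> real" where
  "partial k f x = deriv (\<lambda>t. f (x + t *\<^sub>R axis k 1)) 0"

text \<open>Structural induction on polynomials. The gradient is existentially quantified so that
  the induction carries differentiability and polynomiality of the components together.\<close>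

lemma real_polynomial_function_gradient:
  fixes f :: "real^'n \<Rightarrow> real"
  assumes "real_polynomial_function f"
  shows "\<exists>g. (\<forall>k. real_polynomial_function (g k)) \<and>
    (\<forall>x. (f has_derivative (\<lambda>h. \<Sum>k\<in>UNIV. g k x * h $ k)) (at x))"
  using assms
proof induction
  case (linear f)
  \<comment> \<open>A linear functional is determined by its values on the unit vectors, which form
    its constant gradient.\<close>
  have "f h = (\<Sum>k\<in>UNIV. f (axis k 1) * h $ k)" for h
  proof -
    have lin: "linear f"
      by (rule bounded_linear.linear[OF linear])
    have "f h = f (\<Sum>k\<in>UNIV. h $ k *\<^sub>R axis k 1)"
      by (simp add: basis_expansion scalar_mult_eq_scaleR[symmetric])
    also have "\<dots> = (\<Sum>k\<in>UNIV. f (axis k 1) * h $ k)"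
      by (simp add: linear_sum[OF lin] linear_scale[OF lin] mult.commute)
    finally show ?thesis .
  qed
  then have "f = (\<lambda>h. \<Sum>k\<in>UNIV. f (axis k 1) * h $ k)"
    by (intro ext)
  then have "(f has_derivative (\<lambda>h. \<Sum>k\<in>UNIV. f (axis k 1) * h $ k)) (at x)" for x
    using bounded_linear_imp_has_derivative[OF linear] by (rule has_derivative_eq_rhs[rotated])
  then show ?case
    by (intro exI[of _ "\<lambda>k x. f (axis k 1)"]) (simp add: real_polynomial_function.intros(2))
next
  case (const c)
  show ?case
    by (intro exI[of _ "\<lambda>k x. 0"]) (auto simp: real_polynomial_function.intros(2))
next
  case (add f g)
  then obtain f' g' where "\<forall>k. real_polynomial_function (f' k)" "\<forall>k. real_polynomial_function (g' k)"
      "\<forall>x. (f has_derivative (\<lambda>h. \<Sum>k\<in>UNIV. f' k x * h $ k)) (at x)"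
      "\<forall>x. (g has_derivative (\<lambda>h. \<Sum>k\<in>UNIV. g' k x * h $ k)) (at x)"
    by blast
  then show ?case
    by (intro exI[of _ "\<lambda>k x. f' k x + g' k x"])
      (auto intro!: has_derivative_add[THEN has_derivative_eq_rhs]
        simp: distrib_right sum.distrib)
next
  case (mult f g)
  then obtain f' g' where fg: "\<forall>k. real_polynomial_function (f' k)" "\<forall>k. real_polynomial_function (g' k)"
      "\<forall>x. (f has_derivative (\<lambda>h. \<Sum>k\<in>UNIV. f' k x * h $ k)) (at x)"
      "\<forall>x. (g has_derivative (\<lambda>h. \<Sum>k\<in>UNIV. g' k x * h $ k)) (at x)"
    by blast
  moreover have "((\<lambda>x. f x * g x) has_derivative (\<lambda>h. \<Sum>k\<in>UNIV. (f x * g' k x + f' k x * g x) * h $ k)) (at x)"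
    for x
    using has_derivative_mult[OF fg(3)[rule_format, of x] fg(4)[rule_format, of x]]
    by (rule has_derivative_eq_rhs)
      (simp add: distrib_left distrib_right sum.distrib sum_distrib_left mult_ac)
  ultimately show ?case
    using mult.hyps
    by (intro exI[of _ "\<lambda>k x. f x * g' k x + f' k x * g x"])
      (auto intro!: real_polynomial_function.intros(3,4))
qed

text \<open>Chain rule along a coordinate line. The calculus rules for \<open>partial\<close> below
  follow by computing a total derivative and reading off a component.\<close>

lemma partial_eqI:
  assumes "(f has_derivative (\<lambda>h. \<Sum>k\<in>UNIV. g k * h $ k)) (at x)"
  shows "partial k f x = g k"
proof -
  have "((\<lambda>t. f (x + t *\<^sub>R axis k 1)) has_derivative
      (\<lambda>t. \<Sum>j\<in>UNIV. g j * (t *\<^sub>R axis k 1) $ j)) (at 0)"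
    by (rule has_derivative_compose[of "\<lambda>t. x + t *\<^sub>R axis k 1"])
      (auto intro!: derivative_eq_intros assms)
  also have "(\<lambda>t. \<Sum>j\<in>UNIV. g j * (t *\<^sub>R axis k 1) $ j) = (*) (g k)"
    by (auto simp: fun_eq_iff axis_def if_distrib cong: if_cong)
  finally show ?thesis
    unfolding partial_def by (intro DERIV_imp_deriv) (simp add: has_field_derivative_def)
qed

lemma has_derivative_partial:
  assumes "real_polynomial_function f"
  shows "(f has_derivative (\<lambda>h. \<Sum>k\<in>UNIV. partial k f x * h $ k)) (at x)"
proof -
  obtain g where g: "\<forall>x. (f has_derivative (\<lambda>h. \<Sum>k\<in>UNIV. g k x * h $ k)) (at x)"
    using real_polynomial_function_gradient[OF assms] by blast
  then have "partial k f x = g k x" for k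
    by (intro partial_eqI) auto
  with g show ?thesis by simp
qed

lemma real_polynomial_function_partial [intro]:
  assumes "real_polynomial_function f"
  shows "real_polynomial_function (partial k f)"
proof -
  obtain g where g: "\<forall>k. real_polynomial_function (g k)"
      "\<forall>x. (f has_derivative (\<lambda>h. \<Sum>k\<in>UNIV. g k x * h $ k)) (at x)"
    using real_polynomial_function_gradient[OF assms] by blast
  then have "partial k f = g k"
    by (intro ext partial_eqI) auto
  with g show ?thesis by simp
qed

lemma partial_mult:
  assumes "real_polynomial_function f" "real_polynomial_function g"
  shows "partial k (\<lambda>x. f x * g x) x = partial k f x * g x + f x * partial k g x"
  using has_derivative_mult[OF has_derivative_partial[OF assms(1)] has_derivative_partial[OF assms(2)], of x]
  by (intro partial_eqI)
    (simp add: distrib_right distrib_left sum.distrib sum_distrib_left mult_ac add_ac)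

lemma partial_diff:
  assumes "real_polynomial_function f" "real_polynomial_function g"
  shows "partial k (\<lambda>x. f x - g x) x = partial k f x - partial k g x"
  using has_derivative_diff[OF has_derivative_partial[OF assms(1)] has_derivative_partial[OF assms(2)], of x]
  by (intro partial_eqI) (simp add: left_diff_distrib sum_subtractf)

lemma partial_cmult:
  assumes "real_polynomial_function f"
  shows "partial k (\<lambda>x. c * f x) x = c * partial k f x"
  using has_derivative_mult_right[OF has_derivative_partial[OF assms, of x], of c]
  by (intro partial_eqI) (simp add: sum_distrib_left mult.assoc)

lemma partial_sum:
  assumes "\<And>i. i \<in> I \<Longrightarrow> real_polynomial_function (f i)"
  shows "partial k (\<lambda>x. \<Sum>i\<in>I. f i x) x = (\<Sum>i\<in>I. partial k (f i) x)"
proof (rule partial_eqI)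
  have "((\<lambda>x. \<Sum>i\<in>I. f i x) has_derivative
      (\<lambda>h. \<Sum>i\<in>I. \<Sum>k\<in>UNIV. partial k (f i) x * h $ k)) (at x)"
    by (intro has_derivative_sum has_derivative_partial assms)
  also have "(\<lambda>h. \<Sum>i\<in>I. \<Sum>k\<in>UNIV. partial k (f i) x * h $ k)
      = (\<lambda>h. \<Sum>k\<in>UNIV. (\<Sum>i\<in>I. partial k (f i) x) * h $ k)"
    by (subst sum.swap) (simp add: sum_distrib_right)
  finally show "((\<lambda>x. \<Sum>i\<in>I. f i x) has_derivative
      (\<lambda>h. \<Sum>k\<in>UNIV. (\<Sum>i\<in>I. partial k (f i) x) * h $ k)) (at x)" .
qed

lemma sum_unit_mult:
  fixes a :: "'n::finite \<Rightarrow> real"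
  shows "(\<Sum>k\<in>UNIV. (if k = i then 1 else 0) * a k) = a i"
proof -
  have "(if k = i then 1 else 0) * a k = (if k = i then a k else 0)" for k
    by simp
  then show ?thesis
    by simp
qed

lemma real_polynomial_function_nth [intro]: "real_polynomial_function (\<lambda>x::real^'n. x $ i)"
  by (rule real_polynomial_function.intros(1)) (rule bounded_linear_vec_nth)

lemma partial_nth: "partial k (\<lambda>x. x $ i) x = (if k = i then 1 else 0)"
proof (rule partial_eqI)
  have "((\<lambda>x. x $ i) has_derivative (\<lambda>h. h $ i)) (at x)"
    by (rule bounded_linear_imp_has_derivative) (rule bounded_linear_vec_nth)
  then show "((\<lambda>x. x $ i) has_derivative (\<lambda>h. \<Sum>k\<in>UNIV. (if k = i then 1 else 0) * h $ k)) (at x)"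
    by (simp only: sum_unit_mult)
qed

text \<open>The inner derivative in \<open>laplacian\<close> is needed at every point of the line,
  while \<open>partial\<close> differentiates at parameter \<open>0\<close>; a shift of the
  parameter reconciles the two.\<close>

lemma laplacian_eq_partial: "laplacian f x = (\<Sum>k\<in>UNIV. partial k (partial k f) x)"
  for f :: "real^'n \<Rightarrow> real"
proof -
  have B: "(Basis :: (real^'n) set) = (\<lambda>k. axis k 1) ` UNIV"
    by (auto simp: Basis_vec_def)
  have inj: "inj (\<lambda>k::'n. axis k (1::real))"
    by (auto simp: inj_on_def axis_eq_axis)
  have "deriv (\<lambda>t. f (x + t *\<^sub>R axis k 1)) = (\<lambda>s. partial k f (x + s *\<^sub>R axis k 1))" for k
  proof
    fix s
    have "((\<lambda>t. f (x + t *\<^sub>R axis k 1)) has_field_derivative D) (at s) \<longleftrightarrow>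
      ((\<lambda>t. f (x + s *\<^sub>R axis k 1 + t *\<^sub>R axis k 1)) has_field_derivative D) (at 0)" for D
      using DERIV_shift[of "\<lambda>t. f (x + t *\<^sub>R axis k 1)" D 0 s]
      by (simp add: scaleR_add_left algebra_simps)
    then show "deriv (\<lambda>t. f (x + t *\<^sub>R axis k 1)) s = partial k f (x + s *\<^sub>R axis k 1)"
      unfolding partial_def deriv_def by simp
  qed
  then show ?thesis
    unfolding laplacian_def B sum.reindex[OF inj] o_def
    by (simp add: partial_def[where f = "partial k f" for k])
qed

text \<open>Both sides are the derivative of \<open>f (c *\<^sub>R x) = c ^ l * f x\<close> with
  respect to \<open>c\<close> at \<open>1\<close>.\<close>

lemma euler_identity:
  fixes f :: "real^'n \<Rightarrow> real"
  assumes f: "real_polynomial_function f" and hom: "\<And>c x. f (c *\<^sub>R x) = c ^ l * f x"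
  shows "(\<Sum>k\<in>UNIV. x $ k * partial k f x) = real l * f x"
proof -
  have "((\<lambda>c. f (c *\<^sub>R x)) has_derivative
      (\<lambda>c. \<Sum>k\<in>UNIV. partial k f (1 *\<^sub>R x) * (c *\<^sub>R x) $ k)) (at 1)"
    by (rule has_derivative_compose[of "\<lambda>c. c *\<^sub>R x"])
      (auto intro!: derivative_eq_intros has_derivative_partial[OF f])
  also have "(\<lambda>c. \<Sum>k\<in>UNIV. partial k f (1 *\<^sub>R x) * (c *\<^sub>R x) $ k)
      = (*) (\<Sum>k\<in>UNIV. x $ k * partial k f x)"
    by (simp add: fun_eq_iff sum_distrib_left mult_ac)
  finally have "((\<lambda>c. f (c *\<^sub>R x)) has_field_derivative (\<Sum>k\<in>UNIV. x $ k * partial k f x)) (at 1)"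
    by (simp add: has_field_derivative_def)
  moreover have "((\<lambda>c. c ^ l * f x) has_field_derivative (real l * f x)) (at 1)"
    by (auto intro!: derivative_eq_intros)
  ultimately show ?thesis
    unfolding hom by (rule DERIV_unique)
qed

section \<open>Infinitesimal rotations and orthogonality of harmonics\<close>

definition rotation :: "'n \<Rightarrow> 'n \<Rightarrow> real \<Rightarrow> real^'n \<Rightarrow> real^'n" where
  "rotation i j t x = (\<chi> k. if k = i then cos t * x $ i - sin t * x $ j
     else if k = j then sin t * x $ i + cos t * x $ j else x $ k)"

lemma sum_two_points:
  fixes a :: "'n::finite \<Rightarrow> real"
  assumes "i \<noteq> j" and "\<And>k. k \<noteq> i \<Longrightarrow> k \<noteq> j \<Longrightarrow> a k = 0"
  shows "(\<Sum>k\<in>UNIV. a k) = a i + a j"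
proof -
  have "(\<Sum>k\<in>UNIV. a k) = (\<Sum>k\<in>{i, j}. a k)"
    using assms(2) by (intro sum.mono_neutral_right) auto
  with assms(1) show ?thesis by simp
qed

lemma orthogonal_transformation_rotation:
  assumes "i \<noteq> j"
  shows "orthogonal_transformation (rotation i j t)"
  unfolding orthogonal_transformation
proof (intro conjI allI)
  show "linear (rotation i j t)"
    by (rule linearI) (auto simp: rotation_def vec_eq_iff algebra_simps)
  fix x
  define y where "y = rotation i j t x"
  have "(\<Sum>k\<in>UNIV. (y $ k)\<^sup>2 - (x $ k)\<^sup>2) = ((y $ i)\<^sup>2 - (x $ i)\<^sup>2) + ((y $ j)\<^sup>2 - (x $ j)\<^sup>2)"
    by (rule sum_two_points[OF assms]) (simp add: y_def rotation_def)
  \<comment> \<open>The Pythagorean identity is held back so that both sides expand to the same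
    polynomial in \<open>sin t\<close> and \<open>cos t\<close>; the next step applies it.\<close>
  also have "\<dots> = ((cos t)\<^sup>2 + (sin t)\<^sup>2) * ((x $ i)\<^sup>2 + (x $ j)\<^sup>2) - (x $ i)\<^sup>2 - (x $ j)\<^sup>2"
    using assms by (simp add: y_def rotation_def power2_eq_square algebra_simps
        del: sin_cos_squared_add sin_cos_squared_add2 sin_cos_squared_add3)
  also have "\<dots> = 0"
    by simp
  finally show "norm (rotation i j t x) = norm x"
    by (simp add: norm_vec_def L2_set_def sum_subtractf y_def)
qed

lemma rotation_0: "rotation i j 0 x = x"
  by (auto simp: rotation_def vec_eq_iff)

text \<open>Up to a constant factor the angular momentum operator of the coordinate plane; by
  \<open>has_derivative_rotation\<close> it generates \<open>rotation i j\<close>.\<close>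

definition angular :: "'n \<Rightarrow> 'n \<Rightarrow> (real^'n \<Rightarrow> real) \<Rightarrow> real^'n \<Rightarrow> real" where
  "angular i j f x = x $ i * partial j f x - x $ j * partial i f x"

lemma real_polynomial_function_angular [intro]:
  "real_polynomial_function f \<Longrightarrow> real_polynomial_function (angular i j f)"
  unfolding angular_def[abs_def]
  by (intro real_polynomial_function_diff real_polynomial_function.intros(4)) auto

text \<open>Chain rule: \<open>v\<close> is the velocity of the orbit at \<open>y\<close>, and
  pairing it with the gradient gives \<open>angular\<close>. Every \<open>t\<close> is covered, not
  only \<open>0\<close>, because the mean value bound in \<open>integral_angular\<close> needs the
  derivative along the whole orbit.\<close>

lemma has_derivative_rotation:
  assumes f: "real_polynomial_function f" and ij: "i \<noteq> j"
  shows "((\<lambda>t. f (rotation i j t x)) has_field_derivative angular i j f (rotation i j t x)) (at t)"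
proof -
  define y where "y = rotation i j t x"
  define v :: "real^'a" where "v = (\<chi> k. if k = i then - y $ j else if k = j then y $ i else 0)"
  have "((\<lambda>t. rotation i j t x) has_derivative (\<lambda>s. s *\<^sub>R v)) (at t)"
  proof (rule has_derivative_componentwise_within[THEN iffD2], rule ballI)
    fix b :: "real^'a" assume "b \<in> Basis"
    then obtain k where b: "b = axis k 1"
      by (auto simp: Basis_vec_def)
    have "((\<lambda>t. rotation i j t x $ k) has_real_derivative v $ k) (at t)"
    proof -
      consider "k = i" | "k = j" | "k \<noteq> i" "k \<noteq> j" by blast
      then show ?thesis
      proof cases
        case 1
        then show ?thesis
          using ij by (auto intro!: derivative_eq_intros simp: v_def y_def rotation_def)
      next
        case 2
        then show ?thesis
          using ij by (auto intro!: derivative_eq_intros simp: v_def y_def rotation_def)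
      next
        case 3
        then show ?thesis
          by (simp add: v_def rotation_def)
      qed
    qed
    then have "((\<lambda>t. rotation i j t x $ k) has_derivative (\<lambda>s. v $ k * s)) (at t)"
      by (simp only: has_field_derivative_def)
    then show "((\<lambda>t. rotation i j t x \<bullet> b) has_derivative (\<lambda>s. s *\<^sub>R v \<bullet> b)) (at t)"
      by (simp add: b inner_axis mult.commute[of _ "v $ k"])
  qed
  from has_derivative_compose[OF this has_derivative_partial[OF f]]
  have "((\<lambda>t. f (rotation i j t x)) has_derivative
      (\<lambda>s. \<Sum>k\<in>UNIV. partial k f y * (s *\<^sub>R v) $ k)) (at t)"
    by (simp add: y_def)
  also have "(\<lambda>s. \<Sum>k\<in>UNIV. partial k f y * (s *\<^sub>R v) $ k) = (*) (angular i j f y)"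
  proof
    fix s
    show "(\<Sum>k\<in>UNIV. partial k f y * (s *\<^sub>R v) $ k) = angular i j f y * s"
      by (subst sum_two_points[OF ij]) (use ij in \<open>simp_all add: v_def angular_def algebra_simps\<close>)
  qed
  finally show ?thesis
    by (simp add: has_field_derivative_def y_def)
qed

lemma continuous_on_real_polynomial:
  "real_polynomial_function f \<Longrightarrow> continuous_on A f"
  by (simp add: continuous_on_polymonial_function real_polynomial_function_eq)

text \<open>By rotation invariance the difference quotients of \<open>f\<close> along the rotation
  integrate to \<open>0\<close>. Dominated convergence passes this on to their limit
  \<open>angular i j f\<close>.\<close>

lemma integral_angular:
  fixes f :: "real^3 \<Rightarrow> real"
  assumes f: "real_polynomial_function f" and ij: "i \<noteq> j"
  shows "(LINT x|surface_measure. angular i j f x) = 0"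
proof -
  \<comment> \<open>Difference quotients with angle \<open>1 / Suc n\<close>, which tends to
    \<open>0\<close> without ever being \<open>0\<close>.\<close>
  define s where "s = (\<lambda>n x. (f (rotation i j (1 / real (Suc n)) x) - f x) * real (Suc n))"
  note cont = continuous_on_real_polynomial
  have rot: "orthogonal_transformation (rotation i j t)" for t :: real
    by (rule orthogonal_transformation_rotation[OF ij])
  have norm_rot: "norm (rotation i j t x) = norm x" for t x
    using rot by (simp add: orthogonal_transformation)
  have cont_rot: "continuous_on S2 (\<lambda>x. f (rotation i j t x))" for t
    by (rule continuous_on_compose2[OF cont[OF f, of UNIV]])
      (auto intro!: linear_continuous_on
        simp: linear_conv_bounded_linear[symmetric] orthogonal_transformation_linear[OF rot])
  obtain B where B: "\<And>x. x \<in> S2 \<Longrightarrow> \<bar>angular i j f x\<bar> \<le> B"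
    using bounded_on_S2[OF cont[OF real_polynomial_function_angular[OF f]]] by blast
  have "(\<lambda>n. LINT x|surface_measure. s n x) \<longlonglongrightarrow> (LINT x|surface_measure. angular i j f x)"
  proof (rule integral_dominated_convergence)
    show "angular i j f \<in> borel_measurable surface_measure"
      by (intro borel_measurable_surface cont real_polynomial_function_angular f)
    show "s n \<in> borel_measurable surface_measure" for n
      unfolding s_def by (intro borel_measurable_surface continuous_intros cont_rot cont f)
    show "integrable surface_measure (\<lambda>x. B)"
      by (intro integrable_surface continuous_intros)
    show "AE x in surface_measure. (\<lambda>n. s n x) \<longlonglongrightarrow> angular i j f x"
    proof (rule AE_I2)
      fix x
      have "((\<lambda>h. (f (rotation i j h x) - f x) / h) \<longlongrightarrow> angular i j f x) (at 0)"
        using has_derivative_rotation[OF f ij, of x 0] by (simp add: DERIV_def rotation_0)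
      moreover have "filterlim (\<lambda>n. 1 / real (Suc n)) (at 0) sequentially"
        unfolding filterlim_at using LIMSEQ_inverse_real_of_nat by (auto simp: divide_inverse)
      ultimately show "(\<lambda>n. s n x) \<longlonglongrightarrow> angular i j f x"
        by (drule_tac filterlim_compose) (auto simp: s_def)
    qed
    show "AE x in surface_measure. norm (s n x) \<le> B" for n
    proof (rule AE_I2)
      fix x assume "x \<in> space surface_measure"
      then have x: "norm x = 1"
        by (simp add: space_surface_measure)
      \<comment> \<open>Mean value bound: the orbit stays on the sphere, so the derivative along it
        is bounded by \<open>B\<close> throughout.\<close>
      have "norm (f (rotation i j (1 / real (Suc n)) x) - f (rotation i j 0 x))
          \<le> B * norm (1 / real (Suc n) - 0)"
        by (rule field_differentiable_bound[of UNIV, where f' = "\<lambda>t. angular i j f (rotation i j t x)"])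
          (auto intro!: has_derivative_rotation[OF f ij] B simp: norm_rot x)
      then show "norm (s n x) \<le> B"
        by (simp add: s_def rotation_0 abs_mult pos_le_divide_eq del: of_nat_Suc)
    qed
  qed
  moreover have "(LINT x|surface_measure. s n x) = 0" for n
    unfolding s_def
    using integral_surface_orthogonal[OF rot[of "1 / real (Suc n)"] cont[OF f]]
    by (simp add: integrable_surface cont_rot cont[OF f])
  ultimately show ?thesis
    by (simp add: LIMSEQ_const_iff)
qed

lemma angular_mult:
  assumes "real_polynomial_function f" "real_polynomial_function g"
  shows "angular i j (\<lambda>x. f x * g x) x = angular i j f x * g x + f x * angular i j g x"
  by (simp add: angular_def partial_mult[OF assms] algebra_simps)

text \<open>Integration by parts: the Leibniz rule is integrated, and the integral of
  \<open>angular\<close> of the product vanishes.\<close>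

lemma angular_skew:
  assumes f: "real_polynomial_function f" and g: "real_polynomial_function g" and ij: "i \<noteq> j"
  shows "L2_inner (angular i j f) g = - L2_inner f (angular i j g)"
proof -
  note int = integrable_surface[OF continuous_on_real_polynomial]
  have "0 = (LINT x|surface_measure. angular i j f x * g x + f x * angular i j g x)"
    using integral_angular[OF real_polynomial_function.intros(4)[OF f g] ij]
    by (simp add: angular_mult[OF f g])
  also have "\<dots> = L2_inner (angular i j f) g + L2_inner f (angular i j g)"
    unfolding L2_inner_def
    by (intro Bochner_Integration.integral_add int real_polynomial_function.intros(4)
        real_polynomial_function_angular f g)
  finally show ?thesis by simp
qed

lemma angular_angular_symmetric:
  assumes "real_polynomial_function f" "real_polynomial_function g" "i \<noteq> j"
  shows "L2_inner (angular i j (angular i j f)) g = L2_inner f (angular i j (angular i j g))"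
  using assms by (simp add: angular_skew real_polynomial_function_angular)


text \<open>Both orders of the mixed partial are kept, matching the full double sum of second
  derivatives in \<open>laplace_beltrami_eigenfunction\<close>.\<close>

lemma angular_angular:
  assumes f: "real_polynomial_function f" and ij: "i \<noteq> j"
  shows "angular i j (angular i j f) x =
    (x $ i)\<^sup>2 * partial j (partial j f) x + (x $ j)\<^sup>2 * partial i (partial i f) x
    - x $ i * x $ j * (partial j (partial i f) x + partial i (partial j f) x)
    - x $ i * partial i f x - x $ j * partial j f x"
proof -
  have *: "partial k (angular i j f) x =
      (if k = i then 1 else 0) * partial j f x + x $ i * partial k (partial j f) x
      - ((if k = j then 1 else 0) * partial i f x + x $ j * partial k (partial i f) x)" for k
    unfolding angular_def[abs_def]
    using f by (simp add: partial_diff partial_mult real_polynomial_function.intros(4)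
        real_polynomial_function_nth real_polynomial_function_partial partial_nth del: if_distrib)
  show ?thesis
    using ij unfolding angular_def[of i j "angular i j f"] *
    by (simp add: power2_eq_square algebra_simps)
qed

text \<open>In three dimensions the sum of squares is \<open>|x|^2\<close> times the Laplacian,
  minus \<open>H\<close>, minus twice the Euler operator, where \<open>H\<close> is the sum of
  \<open>x_i x_k\<close> times the second partials. On \<open>P\<close> the Laplacian vanishes, the
  Euler operator gives \<open>l\<close> and \<open>H\<close> gives \<open>l (l - 1)\<close>; hence
  \<open>-(l (l - 1) + 2 l)\<close>.\<close>

lemma laplace_beltrami_eigenfunction:
  assumes P: "P \<in> harmonic_homogeneous l"
  shows "angular 1 2 (angular 1 2 P) x + angular 1 3 (angular 1 3 P) x
    + angular 2 3 (angular 2 3 P) x = - (real l * (real l + 1)) * P x"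
proof -
  have poly: "real_polynomial_function P" and hom: "\<And>c x. P (c *\<^sub>R x) = c ^ l * P x"
    and lap: "laplacian P x = 0"
    using P by (auto simp: harmonic_homogeneous_def)
  note euler = euler_identity[OF poly hom]
  \<comment> \<open>Euler's identity differentiated in direction \<open>i\<close>; the extra
    first-order term comes from differentiating the coordinate \<open>x $ k\<close>.\<close>
  have second: "partial i P x + (\<Sum>k\<in>UNIV. x $ k * partial i (partial k P) x) = real l * partial i P x"
    for i
  proof -
    have "partial i (\<lambda>x. \<Sum>k\<in>UNIV. x $ k * partial k P x) x = partial i (\<lambda>x. real l * P x) x"
      by (simp only: euler)
    moreover have "partial i (\<lambda>x. real l * P x) x = real l * partial i P x"
      by (rule partial_cmult[OF poly])
    moreover have "partial i (\<lambda>x. \<Sum>k\<in>UNIV. x $ k * partial k P x) x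
        = (\<Sum>k\<in>UNIV. (if k = i then 1 else 0) * partial k P x + x $ k * partial i (partial k P) x)"
      using poly by (simp add: partial_sum partial_mult partial_nth eq_commute[of i] real_polynomial_function.intros(4)
          real_polynomial_function_nth real_polynomial_function_partial)
    ultimately show ?thesis
      by (simp only: sum.distrib sum_unit_mult)
  qed
  \<comment> \<open>The differentiated identities are multiplied by \<open>x $ i\<close> and summed.
    The factor \<open>real l - 1\<close> is a real difference, hence correct also for
    \<open>l = 0\<close>.\<close>
  have "(\<Sum>i\<in>UNIV. x $ i * (\<Sum>k\<in>UNIV. x $ k * partial i (partial k P) x))
      = (real l - 1) * (\<Sum>i\<in>UNIV. x $ i * partial i P x)"
  proof -
    have "x $ i * (\<Sum>k\<in>UNIV. x $ k * partial i (partial k P) x) = (real l - 1) * (x $ i * partial i P x)"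
      for i
    proof -
      have "(\<Sum>k\<in>UNIV. x $ k * partial i (partial k P) x) = (real l - 1) * partial i P x"
        using second[of i] by (simp add: left_diff_distrib)
      then show ?thesis by simp
    qed
    then show ?thesis
      by (simp add: sum_distrib_left)
  qed
  then have hess: "(\<Sum>i\<in>UNIV. x $ i * (\<Sum>k\<in>UNIV. x $ k * partial i (partial k P) x))
      = (real l - 1) * real l * P x"
    by (simp add: euler)
  \<comment> \<open>Harmonicity solved for one second partial, so that it can be substituted; what
    remains is a polynomial identity combined with \<open>hess\<close> and Euler's identity.\<close>
  have lap': "partial 1 (partial 1 P) x = - partial 2 (partial 2 P) x - partial 3 (partial 3 P) x"
    using lap by (simp add: laplacian_eq_partial sum_3)
  have ne: "(1::3) \<noteq> 2" "(1::3) \<noteq> 3" "(2::3) \<noteq> 3"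
    by auto
  show ?thesis
    using hess euler[of x]
    unfolding angular_angular[OF poly ne(1)] angular_angular[OF poly ne(2)] angular_angular[OF poly ne(3)]
      sum_3 lap'
    by (simp add: power2_eq_square algebra_simps)
qed

text \<open>Eigenfunctions of a symmetric operator for distinct eigenvalues are orthogonal.\<close>

lemma harmonic_homogeneous_orthogonal:
  assumes P: "P \<in> harmonic_homogeneous l" and Q: "Q \<in> harmonic_homogeneous m" and "l \<noteq> m"
  shows "L2_inner P Q = 0"
proof -
  have poly: "real_polynomial_function P" "real_polynomial_function Q"
    using P Q by (auto simp: harmonic_homogeneous_def)
  note int = integrable_surface[OF continuous_on_real_polynomial]
  \<comment> \<open>On the unit sphere this is the Laplace-Beltrami operator in ambient
    coordinates.\<close>
  define D where "D = (\<lambda>f x. angular 1 2 (angular 1 2 f) x + angular 1 3 (angular 1 3 f) x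
    + angular (2::3) 3 (angular 2 3 f) x)"
  have add1: "L2_inner (\<lambda>x. f x + g x) h = L2_inner f h + L2_inner g h"
    if "real_polynomial_function f" "real_polynomial_function g" "real_polynomial_function h" for f g h
    unfolding L2_inner_def distrib_right
    by (intro Bochner_Integration.integral_add int real_polynomial_function.intros(4) that)
  have comm: "L2_inner f g = L2_inner g f" for f g
    by (simp add: L2_inner_def mult.commute)
  have DL: "L2_inner (D f) g = L2_inner (angular 1 2 (angular 1 2 f)) g
      + L2_inner (angular 1 3 (angular 1 3 f)) g + L2_inner (angular 2 3 (angular 2 3 f)) g"
    if "real_polynomial_function f" "real_polynomial_function g" for f g
    unfolding D_def using that by (simp add: add1 real_polynomial_function.intros(3) real_polynomial_function_angular)
  have ne: "(1::3) \<noteq> 2" "(1::3) \<noteq> 3" "(2::3) \<noteq> 3"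
    by auto
  have "L2_inner (D P) Q = L2_inner P (angular 1 2 (angular 1 2 Q))
      + L2_inner P (angular 1 3 (angular 1 3 Q)) + L2_inner P (angular 2 3 (angular 2 3 Q))"
    using poly by (simp add: DL angular_angular_symmetric ne)
  also have "\<dots> = L2_inner (D Q) P"
    using poly by (simp add: DL comm[of P])
  finally have "L2_inner (D P) Q = L2_inner (D Q) P" .
  moreover have "L2_inner (D P) Q = - (real l * (real l + 1)) * L2_inner P Q"
    unfolding D_def laplace_beltrami_eigenfunction[OF P] by (simp add: L2_inner_def mult.assoc)
  moreover have "L2_inner (D Q) P = - (real m * (real m + 1)) * L2_inner Q P"
    unfolding D_def laplace_beltrami_eigenfunction[OF Q] by (simp add: L2_inner_def mult.assoc)
  ultimately have "(real l * (real l + 1) - real m * (real m + 1)) * L2_inner P Q = 0"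
    by (simp add: comm[of Q P] algebra_simps)
  \<comment> \<open>This factorization shows that distinct degrees have distinct eigenvalues: the
    second factor is positive.\<close>
  moreover have "real l * (real l + 1) - real m * (real m + 1) = (real l - real m) * (real l + real m + 1)"
    by (simp add: algebra_simps)
  moreover have "real l + real m + 1 \<noteq> 0"
    by linarith
  ultimately show ?thesis
    using \<open>l \<noteq> m\<close> by simp
qed

section \<open>Linear combinations, restriction to the sphere and Parseval's identity\<close>

text \<open>Linearity of \<open>partial\<close> rests on differentiability, so the summands and
  their first partials are shown to be polynomials before the Laplacian is moved inside the
  sum.\<close>

lemma harmonic_homogeneous_linear_combination:
  assumes P: "\<And>k. k \<in> K \<Longrightarrow> P k \<in> harmonic_homogeneous l" and K: "finite K"
  shows "(\<lambda>x. \<Sum>k\<in>K. c k * P k x) \<in> harmonic_homogeneous l"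
proof -
  have poly: "real_polynomial_function (P k)" if "k \<in> K" for k
    using P[OF that] by (simp add: harmonic_homogeneous_def)
  then have cpoly: "real_polynomial_function (\<lambda>x. c k * P k x)" if "k \<in> K" for k
    using that by (intro real_polynomial_function.intros(2,4))
  have "partial i (partial i (\<lambda>x. \<Sum>k\<in>K. c k * P k x)) x
      = (\<Sum>k\<in>K. c k * partial i (partial i (P k)) x)" for i x
  proof -
    have "partial i (\<lambda>x. \<Sum>k\<in>K. c k * P k x) = (\<lambda>x. \<Sum>k\<in>K. c k * partial i (P k) x)"
      by (rule ext) (simp add: partial_sum cpoly partial_cmult poly)
    moreover have "real_polynomial_function (\<lambda>x. c k * partial i (P k) x)" if "k \<in> K" for k
      using poly[OF that] by (intro real_polynomial_function.intros(2,4) real_polynomial_function_partial)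
    ultimately show ?thesis
      by (simp add: partial_sum partial_cmult poly real_polynomial_function_partial)
  qed
  then have "laplacian (\<lambda>x. \<Sum>k\<in>K. c k * P k x) x = (\<Sum>k\<in>K. c k * laplacian (P k) x)" for x
    by (simp add: laplacian_eq_partial sum_distrib_left) (rule sum.swap)
  then show ?thesis
    using P cpoly K unfolding harmonic_homogeneous_def
    by (auto intro!: real_polynomial_function_sum sum.cong simp: sum_distrib_left mult_ac)
qed

lemma spherical_harmonics_linear_combination:
  assumes f: "\<And>k. k \<in> K \<Longrightarrow> f k \<in> spherical_harmonics l" and K: "finite K"
  shows "(\<lambda>x\<in>S2. \<Sum>k\<in>K. c k * f k x) \<in> spherical_harmonics l"
proof -
  from f have "\<forall>k\<in>K. \<exists>P. P \<in> harmonic_homogeneous l \<and> f k = restrict P S2"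
    by (auto simp: spherical_harmonics_def)
  then obtain P where P: "\<And>k. k \<in> K \<Longrightarrow> P k \<in> harmonic_homogeneous l"
      "\<And>k. k \<in> K \<Longrightarrow> f k = restrict (P k) S2"
    by metis
  have "(\<lambda>x\<in>S2. \<Sum>k\<in>K. c k * f k x) = (\<lambda>x\<in>S2. \<Sum>k\<in>K. c k * P k x)"
    by (intro restrict_ext sum.cong) (auto simp: P(2))
  with harmonic_homogeneous_linear_combination[OF P(1) K, where c = c] show ?thesis
    by (auto simp: spherical_harmonics_def)
qed

lemma continuous_on_restrict_iff: "continuous_on S (restrict f S) \<longleftrightarrow> continuous_on S f"
  by (rule continuous_on_cong) auto

lemma continuous_on_spherical_harmonics:
  assumes "f \<in> spherical_harmonics l"
  shows "continuous_on S2 f"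
proof -
  obtain P where "real_polynomial_function P" "f = restrict P S2"
    using assms by (auto simp: spherical_harmonics_def harmonic_homogeneous_def)
  then show ?thesis
    by (simp only: continuous_on_restrict_iff continuous_on_real_polynomial)
qed

text \<open>Lets functions that are \<open>undefined\<close> off the sphere be exchanged for the
  polynomials that they restrict.\<close>

lemma L2_inner_cong:
  assumes "\<And>x. x \<in> S2 \<Longrightarrow> f x = f' x" "\<And>x. x \<in> S2 \<Longrightarrow> g x = g' x"
  shows "L2_inner f g = L2_inner f' g'"
  unfolding L2_inner_def using assms
  by (intro Bochner_Integration.integral_cong) (simp_all add: space_surface_measure)

lemma spherical_harmonics_orthogonal:
  assumes f: "f \<in> spherical_harmonics l" and g: "g \<in> spherical_harmonics m" and "l \<noteq> m"
  shows "L2_inner f g = 0"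
proof -
  obtain P Q where P: "P \<in> harmonic_homogeneous l" "f = restrict P S2"
    and Q: "Q \<in> harmonic_homogeneous m" "g = restrict Q S2"
    using f g by (auto simp: spherical_harmonics_def)
  have "L2_inner f g = L2_inner P Q"
    unfolding P Q by (rule L2_inner_cong) auto
  with harmonic_homogeneous_orthogonal[OF P(1) Q(1) \<open>l \<noteq> m\<close>] show ?thesis by simp
qed

text \<open>Finite Parseval identity: the square is expanded into a double sum, and orthonormality
  leaves only the diagonal.\<close>

lemma L2_norm_orthonormal_sum:
  assumes cont: "\<And>i. i \<in> I \<Longrightarrow> continuous_on S2 (e i)"
    and ortho: "\<And>i j. i \<in> I \<Longrightarrow> j \<in> I \<Longrightarrow> L2_inner (e i) (e j) = (if i = j then 1 else 0)"
    and I: "finite I"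
  shows "L2_norm (\<lambda>x\<in>S2. \<Sum>i\<in>I. c i * e i x) = L2_set c I"
proof -
  have "L2_inner (\<lambda>x\<in>S2. \<Sum>i\<in>I. c i * e i x) (\<lambda>x\<in>S2. \<Sum>i\<in>I. c i * e i x)
      = L2_inner (\<lambda>x. \<Sum>i\<in>I. c i * e i x) (\<lambda>x. \<Sum>i\<in>I. c i * e i x)"
    by (rule L2_inner_cong) auto
  also have "\<dots> = (LINT x|surface_measure. (\<Sum>i\<in>I. \<Sum>j\<in>I. c i * c j * (e i x * e j x)))"
    by (simp add: L2_inner_def sum_product mult_ac)
  also have "\<dots> = (\<Sum>i\<in>I. \<Sum>j\<in>I. c i * c j * L2_inner (e i) (e j))"
    unfolding L2_inner_def
    by (subst Bochner_Integration.integral_sum)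
      (auto intro!: integrable_surface continuous_intros cont Bochner_Integration.integrable_sum
        sum.cong Bochner_Integration.integral_sum[THEN trans])
  also have "\<dots> = (\<Sum>i\<in>I. (c i)\<^sup>2)"
  proof (rule sum.cong[OF refl])
    fix i assume i: "i \<in> I"
    have "(\<Sum>j\<in>I. c i * c j * L2_inner (e i) (e j)) = (\<Sum>j\<in>I. if i = j then c i * c j else 0)"
      using i by (intro sum.cong) (auto simp: ortho)
    with i I show "(\<Sum>j\<in>I. c i * c j * L2_inner (e i) (e j)) = (c i)\<^sup>2"
      by (simp add: power2_eq_square)
  qed
  finally show ?thesis
    by (simp add: L2_norm_def L2_set_def)
qed

section \<open>Interpolation by continuous functions, and suprema\<close>

text \<open>Every function on a finite set is continuous and the set is closed in the sphere, so
  Tietze's theorem extends it with the same bound \<open>1\<close>.\<close>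

lemma continuous_interpolation_S2:
  assumes A: "finite A" "A \<subseteq> S2" and v: "\<And>a. a \<in> A \<Longrightarrow> \<bar>v a\<bar> \<le> 1"
  obtains f where "f \<in> continuous_functions_S2" "uniform_norm f \<le> 1" "\<And>a. a \<in> A \<Longrightarrow> f a = v a"
proof -
  have "closedin (top_of_set S2) A"
    using A by (intro closed_subset finite_imp_closed)
  then obtain g where g: "continuous_on S2 g" "\<And>a. a \<in> A \<Longrightarrow> g a = v a"
      "\<And>x. x \<in> S2 \<Longrightarrow> norm (g x) \<le> 1"
    using Tietze[OF continuous_on_finite[OF A(1), of v], of S2 1] v by auto
  show ?thesis
  proof (rule that[of "restrict g S2"])
    show "restrict g S2 \<in> continuous_functions_S2"
      using g(1) by (simp only: continuous_functions_S2_def continuous_on_restrict_iff mem_Collect_eq restrict_extensional simp_thms)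
    show "uniform_norm (restrict g S2) \<le> 1"
      unfolding uniform_norm_def using g(3) by (intro cSUP_least) auto
    show "restrict g S2 a = v a" if "a \<in> A" for a
      using that A g(2) by auto
  qed
qed

text \<open>\<open>uniform_norm\<close> is a supremum in \<open>real\<close>, so an upper bound must
  be known to exist first; compactness of the sphere supplies it.\<close>

lemma abs_le_uniform_norm:
  assumes "f \<in> continuous_functions_S2" "x \<in> S2"
  shows "\<bar>f x\<bar> \<le> uniform_norm f"
proof -
  obtain B where "\<And>x. x \<in> S2 \<Longrightarrow> \<bar>f x\<bar> \<le> B"
    using bounded_on_S2 assms(1) by (auto simp: continuous_functions_S2_def)
  then have "bdd_above ((\<lambda>x. \<bar>f x\<bar>) ` S2)"
    by (intro bdd_aboveI2)
  then show ?thesis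
    unfolding uniform_norm_def by (intro cSUP_upper assms(2))
qed

text \<open>Because of \<open>C > 0\<close> the infimum is not attained when \<open>s = 0\<close>,
  so finite \<open>s\<close> is approached by \<open>r + e\<close>. For infinite \<open>s\<close> no
  real \<open>C\<close> qualifies, and the infimum of the empty set is infinite too.\<close>

lemma INF_ereal_upper_bounds:
  assumes "0 \<le> (s :: ereal)"
  shows "(INF C \<in> {C::real. C > 0 \<and> s \<le> ereal C}. ereal C) = s"
proof (cases s)
  case (real r)
  show ?thesis
  proof (rule antisym)
    show "(INF C \<in> {C::real. C > 0 \<and> s \<le> ereal C}. ereal C) \<le> s"
    proof (rule ereal_le_epsilon2)
      fix e :: real assume "0 < e"
      then show "(INF C \<in> {C::real. C > 0 \<and> s \<le> ereal C}. ereal C) \<le> s + ereal e"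
        using assms real by (intro INF_lower2[of "r + e"]) auto
    qed
  qed (auto intro: INF_greatest)
next
  case PInf
  then show ?thesis by (simp add: top_ereal_def)
next
  case MInf
  with assms show ?thesis by simp
qed

section \<open>Hyperinterpolation\<close>

locale orthonormal_harmonics =
  fixes Y :: "nat \<Rightarrow> int \<Rightarrow> real^3 \<Rightarrow> real"
  assumes basis: "orthonormal_basis_harmonics l (Y l)"
begin

text \<open>Flattens degree and order into one finite index set, so that the bases of all degrees up
  to \<open>n\<close> become a single family \<open>E\<close>.\<close>

definition orders :: "nat \<Rightarrow> (nat \<times> int) set" where
  "orders n = (SIGMA l:{..n}. {-int l..int l})"

definition E :: "nat \<times> int \<Rightarrow> real^3 \<Rightarrow> real" where
  "E b = Y (fst b) (snd b)"

lemma finite_orders: "finite (orders n)"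
  by (simp add: orders_def)

lemma sum_orders:
  "(\<Sum>l\<le>n. \<Sum>k\<in>{-int l..int l}. g l k) = (\<Sum>b\<in>orders n. g (fst b) (snd b))"
  by (simp add: orders_def sum.Sigma case_prod_beta)

lemma E_spherical: "b \<in> orders n \<Longrightarrow> E b \<in> spherical_harmonics (fst b)"
  using basis by (auto simp: orders_def E_def orthonormal_basis_harmonics_def)

lemma E_continuous: "b \<in> orders n \<Longrightarrow> continuous_on S2 (E b)"
  by (rule continuous_on_spherical_harmonics[OF E_spherical])

text \<open>Within one degree this is the assumption on \<open>Y\<close>; across degrees it is
  \<open>spherical_harmonics_orthogonal\<close>.\<close>

lemma E_orthonormal:
  assumes "b \<in> orders n" "b' \<in> orders n"
  shows "L2_inner (E b) (E b') = (if b = b' then 1 else 0)"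
proof (cases "fst b = fst b'")
  case True
  then show ?thesis
    using assms basis[of "fst b"]
    by (auto simp: orders_def E_def orthonormal_basis_harmonics_def prod_eq_iff)
next
  case False
  then show ?thesis
    using spherical_harmonics_orthogonal[OF E_spherical[OF assms(1)] E_spherical[OF assms(2)]] by auto
qed

definition expansion :: "nat \<Rightarrow> (nat \<times> int \<Rightarrow> real) \<Rightarrow> real^3 \<Rightarrow> real" where
  "expansion n c = (\<lambda>x\<in>S2. \<Sum>b\<in>orders n. c b * E b x)"

lemma L2_norm_expansion: "L2_norm (expansion n c) = L2_set c (orders n)"
  unfolding expansion_def
  by (rule L2_norm_orthonormal_sum) (auto simp: E_continuous E_orthonormal finite_orders)

text \<open>In one direction each degree component is expanded in its basis; in the other the
  partial sums over the orders of one degree serve as the components.\<close>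

lemma spherical_polynomials_eq_expansions: "spherical_polynomials n = range (expansion n)"
proof (intro equalityI subsetI)
  fix p assume "p \<in> spherical_polynomials n"
  then obtain h where p: "p = (\<lambda>x\<in>S2. \<Sum>l\<le>n. h l x)" and h: "\<forall>l\<le>n. h l \<in> spherical_harmonics l"
    by (auto simp: spherical_polynomials_def)
  have "\<forall>l. \<exists>c. l \<le> n \<longrightarrow> h l = (\<lambda>x\<in>S2. \<Sum>k\<in>{-int l..int l}. c k * Y l k x)"
    using h basis by (auto simp: orthonormal_basis_harmonics_def)
  then obtain c where c: "\<And>l. l \<le> n \<Longrightarrow> h l = (\<lambda>x\<in>S2. \<Sum>k\<in>{-int l..int l}. c l k * Y l k x)"
    by metis
  have "p = (\<lambda>x\<in>S2. \<Sum>l\<le>n. \<Sum>k\<in>{-int l..int l}. c l k * Y l k x)"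
    unfolding p by (intro restrict_ext sum.cong) (auto simp: c)
  also have "\<dots> = expansion n (\<lambda>b. c (fst b) (snd b))"
    by (simp add: expansion_def E_def sum_orders)
  finally show "p \<in> range (expansion n)" by blast
next
  fix p assume "p \<in> range (expansion n)"
  then obtain c where c: "p = expansion n c" by blast
  define h where "h = (\<lambda>l. \<lambda>x\<in>S2. \<Sum>k\<in>{-int l..int l}. c (l, k) * Y l k x)"
  have "h l \<in> spherical_harmonics l" for l
    unfolding h_def using basis[of l]
    by (intro spherical_harmonics_linear_combination) (auto simp: orthonormal_basis_harmonics_def)
  moreover have "p = (\<lambda>x\<in>S2. \<Sum>l\<le>n. h l x)"
    unfolding c expansion_def E_def h_def
    by (intro restrict_ext) (simp add: sum_orders[symmetric, where g = "\<lambda>l k. c (l, k) * Y l k _", simplified])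
  ultimately show "p \<in> spherical_polynomials n"
    by (auto simp: spherical_polynomials_def)
qed

text \<open>Definiteness of the norm on polynomials follows from Parseval: norm zero forces every
  coefficient to vanish.\<close>

lemma expansion_eq_0_iff: "expansion n c = (\<lambda>y\<in>S2. 0) \<longleftrightarrow> L2_norm (expansion n c) = 0"
proof
  assume "expansion n c = (\<lambda>y\<in>S2. 0)"
  moreover have "L2_inner (\<lambda>y\<in>S2. 0) (\<lambda>y\<in>S2. 0) = L2_inner (\<lambda>_. 0) (\<lambda>_. 0)"
    by (rule L2_inner_cong) auto
  ultimately show "L2_norm (expansion n c) = 0"
    by (simp add: L2_norm_def L2_inner_def)
next
  assume "L2_norm (expansion n c) = 0"
  then have "\<forall>b\<in>orders n. c b = 0"
    by (simp add: L2_norm_expansion L2_set_eq_0_iff finite_orders)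
  then show "expansion n c = (\<lambda>y\<in>S2. 0)"
    by (simp add: expansion_def)
qed

end

section \<open>Quadrature at the nodes and the two inequalities\<close>

locale harmonic_quadrature = orthonormal_harmonics +
  fixes N :: nat and x :: "nat \<Rightarrow> real^3" and w :: "nat \<Rightarrow> real" and n :: nat
  assumes nodes: "j \<in> {1..N} \<Longrightarrow> x j \<in> S2"
    and distinct_nodes: "inj_on x {1..N}"
begin

definition coefficient :: "(real^3 \<Rightarrow> real) \<Rightarrow> nat \<times> int \<Rightarrow> real" where
  "coefficient f b = (\<Sum>j=1..N. w j * (f (x j) * E b (x j)))"

definition mass :: "(real^3 \<Rightarrow> real) \<Rightarrow> real" where
  "mass p = (\<Sum>j=1..N. \<bar>w j\<bar> * \<bar>p (x j)\<bar>)"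

lemma hyperinterpolation_eq_expansion:
  "hyperinterpolation Y n (quadrature N x w) f = expansion n (coefficient f)"
proof -
  \<comment> \<open>The nodes lie on the sphere, where the restricted product takes its ordinary
    values.\<close>
  have "quadrature N x w (\<lambda>y\<in>S2. f y * Y l k y) = coefficient f (l, k)" for l k
    unfolding quadrature_def coefficient_def E_def
    by (intro sum.cong) (use nodes in \<open>auto simp del: mem_sphere_0\<close>)
  then show ?thesis
    unfolding hyperinterpolation_def expansion_def sum_orders by (simp add: E_def)
qed

text \<open>Interchange of two finite sums. It serves twice: with \<open>c = coefficient f\<close>
  it produces the squared norm, and with arbitrary \<open>c\<close> it prepares
  Cauchy-Schwarz.\<close>

lemma quadrature_expansion:
  "(\<Sum>j=1..N. w j * (f (x j) * expansion n c (x j))) = (\<Sum>b\<in>orders n. c b * coefficient f b)"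
proof -
  have "(\<Sum>j=1..N. w j * (f (x j) * expansion n c (x j)))
      = (\<Sum>j=1..N. \<Sum>b\<in>orders n. c b * (w j * (f (x j) * E b (x j))))"
    using nodes by (intro sum.cong) (auto simp: expansion_def sum_distrib_left mult_ac simp del: mem_sphere_0)
  also have "\<dots> = (\<Sum>b\<in>orders n. c b * coefficient f b)"
    by (subst sum.swap) (simp add: coefficient_def sum_distrib_left)
  finally show ?thesis .
qed

lemma mass_nonneg: "0 \<le> mass p"
  by (auto simp: mass_def intro: sum_nonneg)

text \<open>The duality identity is applied to the hyperinterpolant itself, and each
  \<open>f (x j)\<close> is then bounded by \<open>1\<close> in absolute value.\<close>

lemma L2_norm_hyperinterpolation_square_le_mass:
  assumes f: "f \<in> continuous_functions_S2" "uniform_norm f \<le> 1"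
  defines "p \<equiv> expansion n (coefficient f)"
  shows "(L2_norm p)\<^sup>2 \<le> mass p"
proof -
  have "(L2_norm p)\<^sup>2 = (\<Sum>b\<in>orders n. coefficient f b * coefficient f b)"
    by (simp add: p_def L2_norm_expansion L2_set_def sum_nonneg power2_eq_square[symmetric])
  also have "\<dots> = (\<Sum>j=1..N. w j * (f (x j) * p (x j)))"
    by (simp only: p_def quadrature_expansion)
  also have "\<dots> \<le> mass p"
    unfolding mass_def
  proof (rule sum_mono)
    fix j assume "j \<in> {1..N}"
    then have "\<bar>f (x j)\<bar> \<le> 1"
      using abs_le_uniform_norm[OF f(1) nodes] f(2) by fastforce
    then have "\<bar>w j\<bar> * (\<bar>f (x j)\<bar> * \<bar>p (x j)\<bar>) \<le> \<bar>w j\<bar> * (1 * \<bar>p (x j)\<bar>)"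
      by (intro mult_left_mono mult_right_mono) auto
    then show "w j * (f (x j) * p (x j)) \<le> \<bar>w j\<bar> * \<bar>p (x j)\<bar>"
      using abs_ge_self[of "w j * (f (x j) * p (x j))"] by (simp add: abs_mult)
  qed
  finally show ?thesis .
qed

lemma mass_le_hyperinterpolation:
  obtains f where "f \<in> continuous_functions_S2" "uniform_norm f \<le> 1"
    "mass (expansion n c) \<le> L2_norm (expansion n c) * L2_norm (expansion n (coefficient f))"
proof -
  define p where "p = expansion n c"
  \<comment> \<open>The prescribed value must depend on the point, so the index of the node is
    recovered from it; this is where distinctness of the nodes enters. Zeros of the product get the
    value \<open>0\<close>.\<close>
  define v where "v = (\<lambda>a. sgn (w (the_inv_into {1..N} x a) * p a))"
  have "x ` {1..N} \<subseteq> S2"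
    using nodes by blast
  then obtain f where f: "f \<in> continuous_functions_S2" "uniform_norm f \<le> 1"
      "\<And>a. a \<in> x ` {1..N} \<Longrightarrow> f a = v a"
    using continuous_interpolation_S2[of "x ` {1..N}" v] by (auto simp: v_def abs_sgn_eq)
  have "mass p = (\<Sum>j=1..N. w j * (f (x j) * p (x j)))"
    unfolding mass_def
  proof (rule sum.cong[OF refl])
    fix j assume j: "j \<in> {1..N}"
    then have "f (x j) = sgn (w j * p (x j))"
      by (simp add: f(3) v_def the_inv_into_f_f[OF distinct_nodes] del: One_nat_def atLeastAtMost_iff)
    then show "\<bar>w j\<bar> * \<bar>p (x j)\<bar> = w j * (f (x j) * p (x j))"
      by (metis abs_mult abs_sgn mult.assoc mult.commute)
  qed
  also have "\<dots> = (\<Sum>b\<in>orders n. c b * coefficient f b)"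
    by (simp only: p_def quadrature_expansion)
  \<comment> \<open>Absolute values are inserted because the Cauchy-Schwarz inequality
    \<open>L2_set_mult_ineq\<close> is stated with them.\<close>
  also have "\<dots> \<le> (\<Sum>b\<in>orders n. \<bar>c b\<bar> * \<bar>coefficient f b\<bar>)"
    by (intro sum_mono) (metis abs_ge_self abs_mult)
  also have "\<dots> \<le> L2_set c (orders n) * L2_set (coefficient f) (orders n)"
    by (rule L2_set_mult_ineq)
  finally show ?thesis
    using f by (intro that) (simp_all add: p_def L2_norm_expansion)
qed

lemma L2_norm_expansion_nonneg: "0 \<le> L2_norm (expansion n c)"
  by (simp add: L2_norm_expansion)

section \<open>Identification of both constants with the supremum of ratios\<close>

abbreviation ratio_sup :: ereal where
  "ratio_sup \<equiv> (SUP p \<in> {p \<in> spherical_polynomials n. p \<noteq> (\<lambda>y\<in>S2. 0)}. ereal (mass p / L2_norm p))"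

text \<open>An empty supremum would be minus infinity, so a nonzero polynomial must be exhibited.
  All coefficients \<open>1\<close> will do, since \<open>(0, 0)\<close> is an index for every
  \<open>n\<close>.\<close>

lemma ratio_sup_nonneg: "0 \<le> ratio_sup"
proof -
  define c :: "nat \<times> int \<Rightarrow> real" where "c = (\<lambda>b. 1)"
  have "(0, 0) \<in> orders n"
    by (simp add: orders_def)
  then have "L2_norm (expansion n c) \<noteq> 0"
    by (auto simp: L2_norm_expansion L2_set_eq_0_iff finite_orders c_def)
  then have "expansion n c \<in> {p \<in> spherical_polynomials n. p \<noteq> (\<lambda>y\<in>S2. 0)}"
    by (simp add: expansion_eq_0_iff spherical_polynomials_eq_expansions)
  then show ?thesis
    by (rule SUP_upper2) (simp add: mass_nonneg L2_norm_expansion_nonneg)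
qed

lemma operator_norm_eq_ratio_sup:
  "operator_norm_C_L2 (hyperinterpolation Y n (quadrature N x w)) = ratio_sup"
proof (rule antisym)
  show "operator_norm_C_L2 (hyperinterpolation Y n (quadrature N x w)) \<le> ratio_sup"
    unfolding operator_norm_C_L2_def hyperinterpolation_eq_expansion
  proof (rule SUP_least)
    fix f assume "f \<in> {f \<in> continuous_functions_S2. uniform_norm f \<le> 1}"
    then have f: "f \<in> continuous_functions_S2" "uniform_norm f \<le> 1" by auto
    define p where "p = expansion n (coefficient f)"
    show "ereal (L2_norm (expansion n (coefficient f))) \<le> ratio_sup"
    \<comment> \<open>A vanishing hyperinterpolant is no admissible \<open>p\<close>; its norm
      \<open>0\<close> is covered by \<open>ratio_sup_nonneg\<close>. Otherwise it is itself the
      test polynomial.\<close>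
    proof (cases "L2_norm p = 0")
      case True
      then show ?thesis using ratio_sup_nonneg by (simp add: p_def zero_ereal_def)
    next
      case False
      then have pos: "0 < L2_norm p"
        using L2_norm_expansion_nonneg by (simp add: p_def less_le)
      have "p \<in> {p \<in> spherical_polynomials n. p \<noteq> (\<lambda>y\<in>S2. 0)}"
        using False by (simp add: p_def expansion_eq_0_iff spherical_polynomials_eq_expansions)
      moreover have "L2_norm p \<le> mass p / L2_norm p"
        using L2_norm_hyperinterpolation_square_le_mass[OF f] pos
        by (simp add: p_def pos_le_divide_eq power2_eq_square)
      ultimately show ?thesis
        unfolding p_def[symmetric] by (intro SUP_upper2[of p]) simp_all
    qed
  qed
  show "ratio_sup \<le> operator_norm_C_L2 (hyperinterpolation Y n (quadrature N x w))"
    unfolding operator_norm_C_L2_def hyperinterpolation_eq_expansion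
  proof (rule SUP_least)
    fix p assume "p \<in> {p \<in> spherical_polynomials n. p \<noteq> (\<lambda>y\<in>S2. 0)}"
    then obtain c where p: "p = expansion n c" and "L2_norm p \<noteq> 0"
      by (auto simp: spherical_polynomials_eq_expansions expansion_eq_0_iff)
    then have pos: "0 < L2_norm p"
      using L2_norm_expansion_nonneg by (simp add: less_le)
    obtain f where f: "f \<in> continuous_functions_S2" "uniform_norm f \<le> 1"
        "mass p \<le> L2_norm p * L2_norm (expansion n (coefficient f))"
      using mass_le_hyperinterpolation[of c] unfolding p by blast
    then have "mass p / L2_norm p \<le> L2_norm (expansion n (coefficient f))"
      using pos by (simp add: pos_divide_le_eq mult.commute)
    with f show "ereal (mass p / L2_norm p)
        \<le> (SUP f\<in>{f \<in> continuous_functions_S2. uniform_norm f \<le> 1}.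
            ereal (L2_norm (expansion n (coefficient f))))"
      by (intro SUP_upper2[of f]) simp_all
  qed
qed

text \<open>For nonzero \<open>p\<close> the inequality is divided by the positive norm; for the
  zero polynomial, which the supremum omits, both sides vanish.\<close>

lemma MZ_condition_iff: "MZ_condition N x w n C \<longleftrightarrow> ratio_sup \<le> ereal C"
proof -
  have "mass p \<le> C * L2_norm p \<longleftrightarrow> (p \<noteq> (\<lambda>y\<in>S2. 0) \<longrightarrow> mass p / L2_norm p \<le> C)"
    if "p \<in> spherical_polynomials n" for p
  proof (cases "p = (\<lambda>y\<in>S2. 0)")
    case True
    then have "L2_norm p = 0"
      using that by (metis expansion_eq_0_iff imageE spherical_polynomials_eq_expansions)
    moreover have "mass p = 0"
      using True nodes by (auto simp: mass_def simp del: mem_sphere_0)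
    ultimately show ?thesis using True by simp
  next
    case False
    with that have "0 < L2_norm p"
      using L2_norm_expansion_nonneg
      by (auto simp: spherical_polynomials_eq_expansions expansion_eq_0_iff less_le)
    with False show ?thesis
      by (simp add: pos_divide_le_eq)
  qed
  then show ?thesis
    unfolding MZ_condition_def mass_def[symmetric] by (auto simp: SUP_le_iff)
qed

lemma MZ_optimal_constant_eq_ratio_sup: "MZ_optimal_constant N x w n = ratio_sup"
  unfolding MZ_optimal_constant_def MZ_condition_iff
  by (rule INF_ereal_upper_bounds[OF ratio_sup_nonneg])

end

theorem corollary5p4:
  fixes N n :: nat
    and x :: "nat \<Rightarrow> real^3"
    and w :: "nat \<Rightarrow> real"
    and Y :: "nat \<Rightarrow> int \<Rightarrow> real^3 \<Rightarrow> real"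
  assumes Y: "\<And>l. orthonormal_basis_harmonics l (Y l)"
    and nodes: "\<And>j. j \<in> {1..N} \<Longrightarrow> x j \<in> S2"
    and distinct_nodes: "inj_on x {1..N}"
  defines "L \<equiv> hyperinterpolation Y n (quadrature N x w)"
  shows "MZ_optimal_constant N x w n = operator_norm_C_L2 L \<and>
    operator_norm_C_L2 L =
      (SUP p \<in> {p \<in> spherical_polynomials n. p \<noteq> (\<lambda>y\<in>S2. 0)}.
         ereal ((\<Sum>j=1..N. \<bar>w j\<bar> * \<bar>p (x j)\<bar>) / L2_norm p))"
proof -
  interpret harmonic_quadrature Y N x w n
    using Y nodes distinct_nodes by unfold_locales
  show ?thesis
    unfolding L_def using operator_norm_eq_ratio_sup MZ_optimal_constant_eq_ratio_sup
    by (simp add: mass_def)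
qed

end
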